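(* Let $\mathbb{K}$ be $\mathbb{Q}$ or $\mathbb{R}$. Let $P$ be a loop-free program over variables $s_1,\dots,s_m$ with values in $\mathbb{K}$, with semantics formula $\llbracket P\rrbracket$ in free variables $\vec s=(s_1,\dots,s_m)$ (state before execution) and $\vec{s'}=(s'_1,\dots,s'_m)$ (state after execution). Let $$F \;:=\; L_1(\vec s)\le p_1\land\dots\land L_n(\vec s)\le p_n,\qquad F' \;:=\; L'_1(\vec{s'})\le p'_1\land\dots\land L'_{n'}(\vec{s'})\le p'_{n'}$$ be the template constraints on the inputs and outputs of $P$, where the $L_j$ and $L'_j$ are fixed linear forms and $\vec p=(p_1,\dots,p_n)$, $\vec{p'}=(p'_1,\dots,p'_{n'})$ are parameters. For $1\le i\le n'$ define the formulas, with free variables $p_1,\dots,p_n,p'_i$, $$C'_i \;:=\; \forall \vec s,\vec{s'}\;\bigl(F\land\llbracket P\rrbracket \Rightarrow L'_i(\vec{s'})\le p'_i\bigr),$$ $$O'_i \;:=\; C'_i\land\forall p''_i\;\bigl(C'_i[p''_i/p'_i]\Rightarrow p'_i\le p''_i\bigr).$$ Then $O'_i$ defines $p'_i$ as the least possible value for the parameter of the output constraint $L'_i$ after executing the transition $\llbracket P\rrbracket$ from a state verifying $F$. That is, for all $\vec p\in\mathbb{K}^n$ and $p'_i\in\mathbb{K}$, $(\vec p,p'_i)$ satisfies $O'_i$ if and only if $p'_i$ is the least element of the set of all $q\in\mathbb{K}$ such that $L'_i(\vec{s'})\le q$ for every state $\vec{s'}$ that can be reached at the end of an execution of $P$ starting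 in some state $\vec s$ with $L_j(\vec s)\le p_j$ for all $1\le j\le n$.
   Context: All variables and quantifiers range over $\mathbb{K}$. $C[q/p]$ denotes the substitution of $q$ for $p$ in $C$. Loop-free programs over variables $a,b,c,\dots$ (here named $s_1,\dots,s_m$) are built from the constructs below. The semantics of a program $P$ is a formula $\llbracket P\rrbracket$ in unprimed variables (values at the beginning of execution) and primed variables (values at the end) such that $(\vec s,\vec{s'})\models\llbracket P\rrbracket$ if and only if the state $\vec{s'}$ can be reached at the end of an execution of $P$ starting in the state $\vec s$: - Assignment: $\llbracket a:=L(a,b,\dots)+K\rrbracket$ is $a'=L(a,b,\dots)+K\land b'=b\land c'=c\land\cdots$, where $L$ is a linear form and $K\in\mathbb{K}$ is a constant. - Test: $\llbracket \texttt{if } t\texttt{ then }P_1\texttt{ else }P_2\rrbracket$ is $(t\land\llbracket P_1\rrbracket)\lor(\neg t\land\llbracket P_2\rrbracket)$, where $t$ is a test made of linear inequalities in the unprimed variables. - Nondeterministic choice: $\llbracket a:=\texttt{random}\rrbracket$ is $b'=b\land c'=c\land\cdots$ (for all variables except $a$; $a'$ is unconstrained). - Failure: $\llbracket\texttt{fail}\rrbracket$ is false. - Skip: $\llbracket\texttt{skip}\rrbracket$ is $a'=a\land b'=b\land c'=c\land\cdots$. - Sequence: $\llbracket P_1;P_2\rrbracket$ is $\exists a'',b'',\dots\;(f_1\land f_2)$, where $f_1$ is $\llbracket P_1\rrbracket$ with each primed variable replaced by the corresponding double-primed one, and $f_2$ is $\llbracket P_2\rrbracket$ with each unprimed variable replaced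 by the corresponding double-primed one. *)

theory Defs
  imports "Jordan_Normal_Form.Matrix"
begin

section \<open>Formulas of linear arithmetic over an ordered field\<close>

text \<open>
  Locally nameless syntax: free variables are names of type \<open>'x\<close>, bound variables are de Bruijn
  indices. Replacing free names by other free names (\<open>map_fm\<close>) is therefore capture-avoiding.
\<close>

datatype (dead 'k, 'x) trm =
    Free 'x
  | Bound nat
  | Const 'k
  | Plus "('k, 'x) trm" "('k, 'x) trm"
  | Scale 'k "('k, 'x) trm"

datatype (dead 'k, 'x) fm =
    Tru
  | Fls
  | Leq "('k, 'x) trm" "('k, 'x) trm"
  | Less "('k, 'x) trm" "('k, 'x) trm"
  | Eq "('k, 'x) trm" "('k, 'x) trm"
  | Neg "('k, 'x) fm"
  | Conj "('k, 'x) fm" "('k, 'x) fm"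
  | Disj "('k, 'x) fm" "('k, 'x) fm"
  | Impl "('k, 'x) fm" "('k, 'x) fm"
  | AllB "('k, 'x) fm"
  | ExB "('k, 'x) fm"

primrec trm_val :: "'k list \<Rightarrow> ('x \<Rightarrow> 'k) \<Rightarrow> ('k::linordered_field, 'x) trm \<Rightarrow> 'k" where
  "trm_val e \<rho> (Free x) = \<rho> x"
| "trm_val e \<rho> (Bound n) = e ! n"
| "trm_val e \<rho> (Const c) = c"
| "trm_val e \<rho> (Plus t u) = trm_val e \<rho> t + trm_val e \<rho> u"
| "trm_val e \<rho> (Scale c t) = c * trm_val e \<rho> t"

primrec fm_sat :: "'k list \<Rightarrow> ('x \<Rightarrow> 'k) \<Rightarrow> ('k::linordered_field, 'x) fm \<Rightarrow> bool" where
  "fm_sat e \<rho> Tru \<longleftrightarrow> True"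
| "fm_sat e \<rho> Fls \<longleftrightarrow> False"
| "fm_sat e \<rho> (Leq t u) \<longleftrightarrow> trm_val e \<rho> t \<le> trm_val e \<rho> u"
| "fm_sat e \<rho> (Less t u) \<longleftrightarrow> trm_val e \<rho> t < trm_val e \<rho> u"
| "fm_sat e \<rho> (Eq t u) \<longleftrightarrow> trm_val e \<rho> t = trm_val e \<rho> u"
| "fm_sat e \<rho> (Neg f) \<longleftrightarrow> \<not> fm_sat e \<rho> f"
| "fm_sat e \<rho> (Conj f g) \<longleftrightarrow> fm_sat e \<rho> f \<and> fm_sat e \<rho> g"
| "fm_sat e \<rho> (Disj f g) \<longleftrightarrow> fm_sat e \<rho> f \<or> fm_sat e \<rho> g"
| "fm_sat e \<rho> (Impl f g) \<longleftrightarrow> (fm_sat e \<rho> f \<longrightarrow> fm_sat e \<rho> g)"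
| "fm_sat e \<rho> (AllB f) \<longleftrightarrow> (\<forall>v. fm_sat (v # e) \<rho> f)"
| "fm_sat e \<rho> (ExB f) \<longleftrightarrow> (\<exists>v. fm_sat (v # e) \<rho> f)"

definition models :: "('x \<Rightarrow> 'k) \<Rightarrow> ('k::linordered_field, 'x) fm \<Rightarrow> bool" (infix \<open>\<Turnstile>\<close> 50) where
  "\<rho> \<Turnstile> f \<longleftrightarrow> fm_sat [] \<rho> f"

text \<open>\<open>bind d x\<close> turns the free name \<open>x\<close> into the index referring to the binder \<open>d\<close> levels up.\<close>

primrec bind_trm :: "nat \<Rightarrow> 'x \<Rightarrow> ('k, 'x) trm \<Rightarrow> ('k, 'x) trm" where
  "bind_trm d x (Free y) = (if y = x then Bound d else Free y)"
| "bind_trm d x (Bound n) = Bound n"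
| "bind_trm d x (Const c) = Const c"
| "bind_trm d x (Plus t u) = Plus (bind_trm d x t) (bind_trm d x u)"
| "bind_trm d x (Scale c t) = Scale c (bind_trm d x t)"

primrec bind_fm :: "nat \<Rightarrow> 'x \<Rightarrow> ('k, 'x) fm \<Rightarrow> ('k, 'x) fm" where
  "bind_fm d x Tru = Tru"
| "bind_fm d x Fls = Fls"
| "bind_fm d x (Leq t u) = Leq (bind_trm d x t) (bind_trm d x u)"
| "bind_fm d x (Less t u) = Less (bind_trm d x t) (bind_trm d x u)"
| "bind_fm d x (Eq t u) = Eq (bind_trm d x t) (bind_trm d x u)"
| "bind_fm d x (Neg f) = Neg (bind_fm d x f)"
| "bind_fm d x (Conj f g) = Conj (bind_fm d x f) (bind_fm d x g)"
| "bind_fm d x (Disj f g) = Disj (bind_fm d x f) (bind_fm d x g)"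
| "bind_fm d x (Impl f g) = Impl (bind_fm d x f) (bind_fm d x g)"
| "bind_fm d x (AllB f) = AllB (bind_fm (Suc d) x f)"
| "bind_fm d x (ExB f) = ExB (bind_fm (Suc d) x f)"

definition All_fm :: "'x list \<Rightarrow> ('k, 'x) fm \<Rightarrow> ('k, 'x) fm" where
  "All_fm xs f = foldr (\<lambda>x g. AllB (bind_fm 0 x g)) xs f"

definition Ex_fm :: "'x list \<Rightarrow> ('k, 'x) fm \<Rightarrow> ('k, 'x) fm" where
  "Ex_fm xs f = foldr (\<lambda>x g. ExB (bind_fm 0 x g)) xs f"

definition Conj_list :: "('k, 'x) fm list \<Rightarrow> ('k, 'x) fm" where
  "Conj_list fs = foldr Conj fs Tru"

definition subst_fm :: "('k, 'x) fm \<Rightarrow> 'x \<Rightarrow> 'x \<Rightarrow> ('k, 'x) fm" (\<open>_[_'/'/_]\<close> [1000, 0, 0] 1000) where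
  "C[q//p] = map_fm (\<lambda>x. if x = p then q else x) C"

section \<open>Loop-free programs\<close>

text \<open>
  Program variables are numbered \<open>0, \<dots>, m - 1\<close>, a state is an element of \<open>carrier_vec m\<close>, and the
  linear form with coefficient vector \<open>l\<close> maps \<open>s\<close> to \<open>l \<bullet> s\<close>.
\<close>

datatype (dead 'k) test =
    TLeq "'k vec" 'k
  | TLess "'k vec" 'k
  | TNot "'k test"
  | TAnd "'k test" "'k test"
  | TOr "'k test" "'k test"

datatype (dead 'k) prog =
    Assign nat "'k vec" 'k
  | Cond "'k test" "'k prog" "'k prog"
  | Random nat
  | Fail
  | Skip
  | Seq "'k prog" "'k prog"

primrec test_over :: "nat \<Rightarrow> 'k test \<Rightarrow> bool" where
  "test_over m (TLeq l c) \<longleftrightarrow> l \<in> carrier_vec m"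
| "test_over m (TLess l c) \<longleftrightarrow> l \<in> carrier_vec m"
| "test_over m (TNot t) \<longleftrightarrow> test_over m t"
| "test_over m (TAnd t u) \<longleftrightarrow> test_over m t \<and> test_over m u"
| "test_over m (TOr t u) \<longleftrightarrow> test_over m t \<and> test_over m u"

primrec prog_over :: "nat \<Rightarrow> 'k prog \<Rightarrow> bool" where
  "prog_over m (Assign a l c) \<longleftrightarrow> a < m \<and> l \<in> carrier_vec m"
| "prog_over m (Cond t P Q) \<longleftrightarrow> test_over m t \<and> prog_over m P \<and> prog_over m Q"
| "prog_over m (Random a) \<longleftrightarrow> a < m"
| "prog_over m Fail \<longleftrightarrow> True"
| "prog_over m Skip \<longleftrightarrow> True"
| "prog_over m (Seq P Q) \<longleftrightarrow> prog_over m P \<and> prog_over m Q"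

primrec test_holds :: "'k::linordered_field test \<Rightarrow> 'k vec \<Rightarrow> bool" where
  "test_holds (TLeq l c) s \<longleftrightarrow> l \<bullet> s \<le> c"
| "test_holds (TLess l c) s \<longleftrightarrow> l \<bullet> s < c"
| "test_holds (TNot t) s \<longleftrightarrow> \<not> test_holds t s"
| "test_holds (TAnd t u) s \<longleftrightarrow> test_holds t s \<and> test_holds u s"
| "test_holds (TOr t u) s \<longleftrightarrow> test_holds t s \<or> test_holds u s"

text \<open>\<open>exec P s s'\<close>: some execution of \<open>P\<close> started in state \<open>s\<close> ends in state \<open>s'\<close>.\<close>

inductive exec :: "'k::linordered_field prog \<Rightarrow> 'k vec \<Rightarrow> 'k vec \<Rightarrow> bool" where
  Assign: "exec (Assign a l c) s (s |\<^sub>v a \<mapsto> l \<bullet> s + c)"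
| CondTrue: "test_holds t s \<Longrightarrow> exec P s s' \<Longrightarrow> exec (Cond t P Q) s s'"
| CondFalse: "\<not> test_holds t s \<Longrightarrow> exec Q s s' \<Longrightarrow> exec (Cond t P Q) s s'"
| Random: "exec (Random a) s (s |\<^sub>v a \<mapsto> v)"
| Skip: "exec Skip s s"
| Seq: "exec P s s'' \<Longrightarrow> exec Q s'' s' \<Longrightarrow> exec (Seq P Q) s s'"

section \<open>Semantics formula of a program\<close>

text \<open>
  \<open>Pre k\<close>, \<open>Post k\<close>, \<open>Mid k\<close> are the unprimed, primed and double-primed copies of program variable
  \<open>k\<close>; \<open>ParIn j\<close> is $p_j$, and \<open>ParOut i\<close>, \<open>ParOut' i\<close> are $p'_i$, $p''_i$.
\<close>

datatype name = Pre nat | Post nat | Mid nat | ParIn nat | ParOut nat | ParOut' nat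

definition lin :: "(nat \<Rightarrow> 'x) \<Rightarrow> 'k::linordered_field vec \<Rightarrow> ('k, 'x) trm" where
  "lin X l = foldr (\<lambda>k t. Plus (Scale (l $ k) (Free (X k))) t) [0..<dim_vec l] (Const 0)"

primrec test_fm :: "'k::linordered_field test \<Rightarrow> ('k, name) fm" where
  "test_fm (TLeq l c) = Leq (lin Pre l) (Const c)"
| "test_fm (TLess l c) = Less (lin Pre l) (Const c)"
| "test_fm (TNot t) = Neg (test_fm t)"
| "test_fm (TAnd t u) = Conj (test_fm t) (test_fm u)"
| "test_fm (TOr t u) = Disj (test_fm t) (test_fm u)"

definition unchanged :: "nat list \<Rightarrow> ('k, name) fm" where
  "unchanged ks = Conj_list (map (\<lambda>k. Eq (Free (Post k)) (Free (Pre k))) ks)"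

fun post_to_mid :: "name \<Rightarrow> name" where
  "post_to_mid (Post k) = Mid k"
| "post_to_mid x = x"

fun pre_to_mid :: "name \<Rightarrow> name" where
  "pre_to_mid (Pre k) = Mid k"
| "pre_to_mid x = x"

primrec sem :: "nat \<Rightarrow> 'k::linordered_field prog \<Rightarrow> ('k, name) fm" where
  "sem m (Assign a l c) =
     Conj (Eq (Free (Post a)) (Plus (lin Pre l) (Const c)))
          (unchanged (filter (\<lambda>k. k \<noteq> a) [0..<m]))"
| "sem m (Cond t P Q) =
     Disj (Conj (test_fm t) (sem m P)) (Conj (Neg (test_fm t)) (sem m Q))"
| "sem m (Random a) = unchanged (filter (\<lambda>k. k \<noteq> a) [0..<m])"
| "sem m Fail = Fls"
| "sem m Skip = unchanged [0..<m]"
| "sem m (Seq P Q) =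
     Ex_fm (map Mid [0..<m])
       (Conj (map_fm post_to_mid (sem m P)) (map_fm pre_to_mid (sem m Q)))"

section \<open>Template constraints and the optimal-parameter formula\<close>

definition template_atom :: "(nat \<Rightarrow> name) \<Rightarrow> (nat \<Rightarrow> name) \<Rightarrow> 'k::linordered_field vec list \<Rightarrow> nat
    \<Rightarrow> ('k, name) fm" where
  "template_atom X Par L j = Leq (lin X (L ! j)) (Free (Par j))"

definition template :: "(nat \<Rightarrow> name) \<Rightarrow> (nat \<Rightarrow> name) \<Rightarrow> 'k::linordered_field vec list
    \<Rightarrow> ('k, name) fm" where
  "template X Par L = Conj_list (map (template_atom X Par L) [0..<length L])"

text \<open>
  With \<open>F = template Pre ParIn L\<close> on the inputs and \<open>F' = template Post ParOut L'\<close> on the outputs,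
  constraints being numbered from 0, the following are $C'_i$ (whose conclusion is the \<open>i\<close>-th
  conjunct of \<open>F'\<close>) and $O'_i$.
\<close>

definition correct_fm :: "nat \<Rightarrow> 'k::linordered_field prog \<Rightarrow> 'k vec list \<Rightarrow> 'k vec list \<Rightarrow> nat
    \<Rightarrow> ('k, name) fm" where
  "correct_fm m P L L' i =
     All_fm (map Pre [0..<m] @ map Post [0..<m])
       (Impl (Conj (template Pre ParIn L) (sem m P)) (template_atom Post ParOut L' i))"

definition optimal_fm :: "nat \<Rightarrow> 'k::linordered_field prog \<Rightarrow> 'k vec list \<Rightarrow> 'k vec list \<Rightarrow> nat
    \<Rightarrow> ('k, name) fm" where
  "optimal_fm m P L L' i =
     (let C = correct_fm m P L L' i in
      Conj C (All_fm [ParOut' i]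
        (Impl (C[ParOut' i//ParOut i]) (Leq (Free (ParOut i)) (Free (ParOut' i))))))"

definition post_bounds :: "nat \<Rightarrow> 'k::linordered_field prog \<Rightarrow> 'k vec list \<Rightarrow> 'k vec \<Rightarrow> 'k vec
    \<Rightarrow> 'k set" where
  "post_bounds m P L p l' =
     {q. \<forall>s s'. s \<in> carrier_vec m \<and> (\<forall>j < length L. L ! j \<bullet> s \<le> p $ j) \<and> exec P s s'
            \<longrightarrow> l' \<bullet> s' \<le> q}"

end

theory Submission
  imports Defs
begin

text \<open>
  Each formula holds under a valuation exactly when its intended meaning holds for the states and
  parameters read off the valuation. Because binding a free name does not shift the indices already
  present, quantifying over that name has the expected meaning only for formulas without dangling
  indices, and every formula built here is of that kind.
\<close>

section \<open>Quantification over free names\<close>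

primrec lc_trm :: "nat \<Rightarrow> ('k, 'x) trm \<Rightarrow> bool" where
  "lc_trm d (Free x) \<longleftrightarrow> True"
| "lc_trm d (Bound n) \<longleftrightarrow> n < d"
| "lc_trm d (Const c) \<longleftrightarrow> True"
| "lc_trm d (Plus t u) \<longleftrightarrow> lc_trm d t \<and> lc_trm d u"
| "lc_trm d (Scale c t) \<longleftrightarrow> lc_trm d t"

text \<open>Local closure at depth \<open>d\<close>: an index may point to a binder inside the
  formula or to one of \<open>d\<close> binders assumed around it. Depth 0 means that no index
  dangles.\<close>

primrec lc_fm :: "nat \<Rightarrow> ('k, 'x) fm \<Rightarrow> bool" where
  "lc_fm d Tru \<longleftrightarrow> True"
| "lc_fm d Fls \<longleftrightarrow> True"
| "lc_fm d (Leq t u) \<longleftrightarrow> lc_trm d t \<and> lc_trm d u"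
| "lc_fm d (Less t u) \<longleftrightarrow> lc_trm d t \<and> lc_trm d u"
| "lc_fm d (Eq t u) \<longleftrightarrow> lc_trm d t \<and> lc_trm d u"
| "lc_fm d (Neg f) \<longleftrightarrow> lc_fm d f"
| "lc_fm d (Conj f g) \<longleftrightarrow> lc_fm d f \<and> lc_fm d g"
| "lc_fm d (Disj f g) \<longleftrightarrow> lc_fm d f \<and> lc_fm d g"
| "lc_fm d (Impl f g) \<longleftrightarrow> lc_fm d f \<and> lc_fm d g"
| "lc_fm d (AllB f) \<longleftrightarrow> lc_fm (Suc d) f"
| "lc_fm d (ExB f) \<longleftrightarrow> lc_fm (Suc d) f"

lemma lc_bind_trm: "lc_trm d t \<Longrightarrow> lc_trm (Suc d) (bind_trm d x t)"
  by (induction t) auto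

text \<open>Binding creates the index \<open>d\<close>, raised by one under each binder exactly as
  the bound on indices is; older indices stay as they were.\<close>

lemma lc_bind_fm: "lc_fm d f \<Longrightarrow> lc_fm (Suc d) (bind_fm d x f)"
  by (induction f arbitrary: d) (auto simp: lc_bind_trm)

lemma lc_map_trm [simp]: "lc_trm d (map_trm g t) \<longleftrightarrow> lc_trm d t"
  by (induction t) auto

lemma lc_map_fm [simp]: "lc_fm d (map_fm g f) \<longleftrightarrow> lc_fm d f"
  by (induction f arbitrary: d) auto

lemma lc_All_fm: "lc_fm 0 f \<Longrightarrow> lc_fm 0 (All_fm xs f)"
  by (induction xs) (auto simp: All_fm_def lc_bind_fm)

lemma lc_Ex_fm: "lc_fm 0 f \<Longrightarrow> lc_fm 0 (Ex_fm xs f)"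
  by (induction xs) (auto simp: Ex_fm_def lc_bind_fm)

lemma lc_Conj_list [simp]: "lc_fm d (Conj_list fs) \<longleftrightarrow> (\<forall>f \<in> set fs. lc_fm d f)"
  by (induction fs) (auto simp: Conj_list_def)

lemma trm_val_bind:
  "lc_trm (length e) t \<Longrightarrow>
    trm_val (e @ [v]) \<rho> (bind_trm (length e) x t) = trm_val e (\<rho>(x := v)) t"
  by (induction t) (auto simp: nth_append)

text \<open>The new index points just past \<open>e\<close>, so \<open>v\<close> is appended at the
  far end, while local closure keeps every older index inside \<open>e\<close>. The case
  \<open>e = []\<close> is the one applied later; a general \<open>e\<close> carries the induction,
  where a binder lengthens the environment and raises the new index together.\<close>

lemma fm_sat_bind:
  "lc_fm (length e) f \<Longrightarrow>
    fm_sat (e @ [v]) \<rho> (bind_fm (length e) x f) \<longleftrightarrow> fm_sat e (\<rho>(x := v)) f"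
proof (induction f arbitrary: e)
  case (AllB f)
  then show ?case using AllB.IH[of "w # e" for w] by simp
next
  case (ExB f)
  then show ?case using ExB.IH[of "w # e" for w] by simp
qed (auto simp: trm_val_bind)

lemma trm_val_map: "trm_val e \<rho> (map_trm g t) = trm_val e (\<rho> \<circ> g) t"
  by (induction t) auto

text \<open>Bound variables are indices, so renaming cannot capture and only changes where the
  valuation looks up free names.\<close>

lemma fm_sat_map: "fm_sat e \<rho> (map_fm g f) \<longleftrightarrow> fm_sat e (\<rho> \<circ> g) f"
  by (induction f arbitrary: e) (auto simp: trm_val_map)

lemma models_map_fm: "\<rho> \<Turnstile> map_fm g f \<longleftrightarrow> \<rho> \<circ> g \<Turnstile> f"
  by (simp add: models_def fm_sat_map)

lemma models_simps [simp]:
  "\<not> \<rho> \<Turnstile> Fls"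
  "\<rho> \<Turnstile> Leq t u \<longleftrightarrow> trm_val [] \<rho> t \<le> trm_val [] \<rho> u"
  "\<rho> \<Turnstile> Less t u \<longleftrightarrow> trm_val [] \<rho> t < trm_val [] \<rho> u"
  "\<rho> \<Turnstile> Eq t u \<longleftrightarrow> trm_val [] \<rho> t = trm_val [] \<rho> u"
  "\<rho> \<Turnstile> Neg f \<longleftrightarrow> \<not> \<rho> \<Turnstile> f"
  "\<rho> \<Turnstile> Conj f g \<longleftrightarrow> \<rho> \<Turnstile> f \<and> \<rho> \<Turnstile> g"
  "\<rho> \<Turnstile> Disj f g \<longleftrightarrow> \<rho> \<Turnstile> f \<or> \<rho> \<Turnstile> g"
  "\<rho> \<Turnstile> Impl f g \<longleftrightarrow> (\<rho> \<Turnstile> f \<longrightarrow> \<rho> \<Turnstile> g)"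
  by (simp_all add: models_def)

lemma models_Conj_list [simp]: "\<rho> \<Turnstile> Conj_list fs \<longleftrightarrow> (\<forall>f \<in> set fs. \<rho> \<Turnstile> f)"
  by (induction fs) (auto simp: Conj_list_def models_def)

lemma models_AllB_bind: "lc_fm 0 f \<Longrightarrow> \<rho> \<Turnstile> AllB (bind_fm 0 x f) \<longleftrightarrow> (\<forall>v. \<rho>(x := v) \<Turnstile> f)"
  by (simp add: models_def fm_sat_bind[of "[]", simplified])

lemma models_ExB_bind: "lc_fm 0 f \<Longrightarrow> \<rho> \<Turnstile> ExB (bind_fm 0 x f) \<longleftrightarrow> (\<exists>v. \<rho>(x := v) \<Turnstile> f)"
  by (simp add: models_def fm_sat_bind[of "[]", simplified])

text \<open>The witness for \<open>v\<close> is \<open>\<sigma> x\<close>. This absorbs an outermost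
  binder into the set of names left unconstrained, which is the induction step for blocks of
  quantifiers.\<close>

lemma ex_fun_upd_agree_iff:
  "(\<exists>v. \<forall>y. y \<notin> A \<longrightarrow> \<sigma> y = (\<rho>(x := v)) y) \<longleftrightarrow> (\<forall>y. y \<notin> insert x A \<longrightarrow> \<sigma> y = \<rho> y)"
  by (metis fun_upd_apply insert_iff)

text \<open>Each binder frees one more name of the valuation. Describing the block by a single
  \<open>\<sigma>\<close> instead of a list of values makes order and repetition of names
  irrelevant, and lets later witnesses set many names at once.\<close>

lemma models_All_fm:
  assumes "lc_fm 0 f"
  shows "\<rho> \<Turnstile> All_fm xs f \<longleftrightarrow> (\<forall>\<sigma>. (\<forall>y. y \<notin> set xs \<longrightarrow> \<sigma> y = \<rho> y) \<longrightarrow> \<sigma> \<Turnstile> f)"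
proof (induction xs arbitrary: \<rho>)
  case Nil
  \<comment> \<open>Agreement at every name is equality of functions, so \<open>\<sigma>\<close> can
    only be \<open>\<rho>\<close>.\<close>
  show ?case by (simp add: All_fm_def flip: fun_eq_iff)
next
  case (Cons x xs)
  have "\<rho> \<Turnstile> All_fm (x # xs) f \<longleftrightarrow> (\<forall>v. \<rho>(x := v) \<Turnstile> All_fm xs f)"
    using models_AllB_bind[OF lc_All_fm[OF assms]] by (simp add: All_fm_def)
  also have "\<dots> \<longleftrightarrow> (\<forall>\<sigma>. (\<exists>v. \<forall>y. y \<notin> set xs \<longrightarrow> \<sigma> y = (\<rho>(x := v)) y) \<longrightarrow> \<sigma> \<Turnstile> f)"
    unfolding Cons.IH by blast
  finally show ?case unfolding ex_fun_upd_agree_iff by simp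
qed

lemma models_Ex_fm:
  assumes "lc_fm 0 f"
  shows "\<rho> \<Turnstile> Ex_fm xs f \<longleftrightarrow> (\<exists>\<sigma>. (\<forall>y. y \<notin> set xs \<longrightarrow> \<sigma> y = \<rho> y) \<and> \<sigma> \<Turnstile> f)"
proof (induction xs arbitrary: \<rho>)
  case Nil
  show ?case by (simp add: Ex_fm_def flip: fun_eq_iff)
next
  case (Cons x xs)
  have "\<rho> \<Turnstile> Ex_fm (x # xs) f \<longleftrightarrow> (\<exists>v. \<rho>(x := v) \<Turnstile> Ex_fm xs f)"
    using models_ExB_bind[OF lc_Ex_fm[OF assms]] by (simp add: Ex_fm_def)
  also have "\<dots> \<longleftrightarrow> (\<exists>\<sigma>. (\<exists>v. \<forall>y. y \<notin> set xs \<longrightarrow> \<sigma> y = (\<rho>(x := v)) y) \<and> \<sigma> \<Turnstile> f)"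
    unfolding Cons.IH by blast
  finally show ?case unfolding ex_fun_upd_agree_iff by simp
qed

section \<open>Adequacy of the program semantics\<close>

abbreviation state_of :: "nat \<Rightarrow> (nat \<Rightarrow> 'x) \<Rightarrow> ('x \<Rightarrow> 'k) \<Rightarrow> 'k vec" where
  "state_of m X \<rho> \<equiv> vec m (\<lambda>k. \<rho> (X k))"

lemma lc_lin [simp]: "lc_trm d (lin X l)"
proof -
  \<comment> \<open>Stated for any list \<open>ks\<close>, because a tail of \<open>[0..<n]\<close>
    no longer starts at 0.\<close>
  have "lc_trm d (foldr (\<lambda>k t. Plus (Scale (l $ k) (Free (X k))) t) ks (Const 0))" for ks
    by (induction ks) auto
  then show ?thesis by (simp add: lin_def)
qed

text \<open>The sum in \<open>lin\<close> runs up to \<open>dim_vec l\<close>, the scalar product up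
  to the dimension of the state; the hypothesis makes the two ranges equal.\<close>

lemma trm_val_lin:
  assumes "l \<in> carrier_vec m"
  shows "trm_val e \<rho> (lin X l) = l \<bullet> state_of m X \<rho>"
proof -
  have "trm_val e \<rho> (foldr (\<lambda>k t. Plus (Scale (l $ k) (Free (X k))) t) ks (Const 0))
      = (\<Sum>k \<leftarrow> ks. l $ k * \<rho> (X k))" for ks
    by (induction ks) auto
  with assms show ?thesis
    by (simp add: lin_def scalar_prod_def interv_sum_list_conv_sum_set_nat)
qed

lemma lc_test_fm [simp]: "lc_fm d (test_fm t)"
  by (induction t) auto

lemma lc_unchanged [simp]: "lc_fm d (unchanged ks)"
  by (auto simp: unchanged_def)

lemma models_unchanged: "\<rho> \<Turnstile> unchanged ks \<longleftrightarrow> (\<forall>k \<in> set ks. \<rho> (Post k) = \<rho> (Pre k))"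
  by (simp add: unchanged_def)

lemma lc_sem [simp]: "lc_fm 0 (sem m P)"
  by (induction P) (auto intro: lc_Ex_fm)

lemma models_test_fm:
  "test_over m t \<Longrightarrow> \<rho> \<Turnstile> test_fm t \<longleftrightarrow> test_holds t (state_of m Pre \<rho>)"
  by (induction t) (auto simp: trm_val_lin)

text \<open>Updates keep the dimension and the other rules only pass states on. Reachable states are
  thus determined by their entries below \<open>m\<close>, which is all that a valuation records of
  them.\<close>

lemma exec_carrier: "exec P s s' \<Longrightarrow> s \<in> carrier_vec m \<Longrightarrow> s' \<in> carrier_vec m"
  by (induction rule: exec.induct) (auto simp: update_vec_def)

inductive_cases exec_AssignE: "exec (Assign a l c) s s'"
inductive_cases exec_CondE: "exec (Cond t P Q) s s'"
inductive_cases exec_RandomE: "exec (Random a) s s'"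
inductive_cases exec_FailE: "exec Fail s s'"
inductive_cases exec_SkipE: "exec Skip s s'"
inductive_cases exec_SeqE: "exec (Seq P Q) s s'"

lemma exec_iff:
  "exec (Assign a l c) s s' \<longleftrightarrow> s' = s |\<^sub>v a \<mapsto> l \<bullet> s + c"
  "exec (Cond t P Q) s s' \<longleftrightarrow> (if test_holds t s then exec P s s' else exec Q s s')"
  "exec (Random a) s s' \<longleftrightarrow> (\<exists>v. s' = s |\<^sub>v a \<mapsto> v)"
  "\<not> exec Fail s s'"
  "exec Skip s s' \<longleftrightarrow> s' = s"
  "exec (Seq P Q) s s' \<longleftrightarrow> (\<exists>s''. exec P s s'' \<and> exec Q s'' s')"
  by (auto intro: exec.intros elim: exec_AssignE exec_CondE exec_RandomE exec_FailE exec_SkipE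
      exec_SeqE)

text \<open>Entrywise comparison, in the shape of the formulas for assignment and random choice. The
  bound \<open>a < m\<close> matters: an update beyond the dimension changes nothing and would not
  constrain \<open>\<rho> (X a)\<close>.\<close>

lemma state_of_eq_update_iff:
  assumes "a < m"
  shows "state_of m X \<rho> = state_of m Y \<rho> |\<^sub>v a \<mapsto> v \<longleftrightarrow>
    \<rho> (X a) = v \<and> (\<forall>k < m. k \<noteq> a \<longrightarrow> \<rho> (X k) = \<rho> (Y k))"
  using assms by (auto simp: vec_eq_iff update_vec_def)

text \<open>Induction on the program, with \<open>\<rho>\<close> arbitrary because a sequence
  evaluates its parts under renamed valuations. Nested sequences share the \<open>Mid\<close> names
  without conflict: by the induction hypothesis the truth of a part depends on the
  \<open>Pre\<close> and \<open>Post\<close> copies alone.\<close>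

lemma models_sem:
  "prog_over m P \<Longrightarrow> \<rho> \<Turnstile> sem m P \<longleftrightarrow> exec P (state_of m Pre \<rho>) (state_of m Post \<rho>)"
proof (induction P arbitrary: \<rho>)
  case (Assign a l c)
  then show ?case
    by (auto simp: exec_iff state_of_eq_update_iff models_unchanged trm_val_lin)
next
  case (Cond t P Q)
  then show ?case by (auto simp: exec_iff models_test_fm)
next
  case (Random a)
  then show ?case by (auto simp: exec_iff state_of_eq_update_iff models_unchanged)
next
  case Fail
  show ?case by (simp add: exec_iff)
next
  case Skip
  show ?case by (auto simp: exec_iff models_unchanged vec_eq_iff)
next
  case (Seq P Q)
  let ?s = "state_of m Pre \<rho>" and ?s' = "state_of m Post \<rho>"
  let ?agree = "\<lambda>\<sigma>. \<forall>y. y \<notin> set (map Mid [0..<m]) \<longrightarrow> \<sigma> y = \<rho> y"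
  have "\<rho> \<Turnstile> sem m (Seq P Q) \<longleftrightarrow>
      (\<exists>\<sigma>. ?agree \<sigma> \<and> \<sigma> \<circ> post_to_mid \<Turnstile> sem m P \<and> \<sigma> \<circ> pre_to_mid \<Turnstile> sem m Q)"
    by (simp add: models_Ex_fm models_map_fm)
  \<comment> \<open>Under \<open>\<sigma> \<circ> post_to_mid\<close> the \<open>Post\<close> copy
    reads the \<open>Mid\<close> names of \<open>\<sigma>\<close>, and likewise for the
    \<open>Pre\<close> copy under \<open>\<sigma> \<circ> pre_to_mid\<close>.\<close>
  also have "\<dots> \<longleftrightarrow>
      (\<exists>\<sigma>. ?agree \<sigma> \<and> exec P (state_of m Pre \<sigma>) (state_of m Mid \<sigma>)
        \<and> exec Q (state_of m Mid \<sigma>) (state_of m Post \<sigma>))"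
    using Seq by simp
  also have "\<dots> \<longleftrightarrow>
      (\<exists>\<sigma>. ?agree \<sigma> \<and> exec P ?s (state_of m Mid \<sigma>) \<and> exec Q (state_of m Mid \<sigma>) ?s')"
  proof -
    have "state_of m Pre \<sigma> = ?s \<and> state_of m Post \<sigma> = ?s'" if "?agree \<sigma>" for \<sigma>
      using that by (auto simp: vec_eq_iff)
    then show ?thesis by metis
  qed
  also have "\<dots> \<longleftrightarrow> (\<exists>s''. exec P ?s s'' \<and> exec Q s'' ?s')"
  proof
    assume "\<exists>s''. exec P ?s s'' \<and> exec Q s'' ?s'"
    then obtain s'' where ex: "exec P ?s s''" "exec Q s'' ?s'" by blast
    have dim: "s'' \<in> carrier_vec m" using exec_carrier[OF ex(1)] by simp
    \<comment> \<open>\<open>\<sigma>\<close> stores the intermediate state in the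
      \<open>Mid\<close> copy. The guard \<open>k < m\<close> is needed for agreement with
      \<open>\<rho>\<close>, since \<open>Mid k\<close> is not quantified for larger
      \<open>k\<close>.\<close>
    define \<sigma> where
      "\<sigma> x = (case x of Mid k \<Rightarrow> if k < m then s'' $ k else \<rho> x | _ \<Rightarrow> \<rho> x)" for x
    have "state_of m Mid \<sigma> = s''" using dim by (auto simp: \<sigma>_def)
    moreover have "?agree \<sigma>" by (auto simp: \<sigma>_def split: name.split)
    ultimately show
      "\<exists>\<sigma>. ?agree \<sigma> \<and> exec P ?s (state_of m Mid \<sigma>) \<and> exec Q (state_of m Mid \<sigma>) ?s'"
      using ex by metis
  qed blast
  finally show ?case by (simp add: exec_iff)
qed

section \<open>Optimal parameters\<close>

lemma lc_template_atom [simp]: "lc_fm d (template_atom X Par L j)"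
  by (simp add: template_atom_def)

lemma lc_template [simp]: "lc_fm d (template X Par L)"
  by (auto simp: template_def)

lemma lc_correct_fm: "lc_fm 0 (correct_fm m P L L' i)"
  by (simp add: correct_fm_def lc_All_fm)

lemma models_template_atom:
  assumes "set L \<subseteq> carrier_vec m" "j < length L"
  shows "\<rho> \<Turnstile> template_atom X Par L j \<longleftrightarrow> L ! j \<bullet> state_of m X \<rho> \<le> \<rho> (Par j)"
proof -
  have "L ! j \<in> carrier_vec m" using assms nth_mem by blast
  then show ?thesis by (simp add: template_atom_def trm_val_lin)
qed

lemma models_template:
  assumes "set L \<subseteq> carrier_vec m"
  shows "\<rho> \<Turnstile> template X Par L \<longleftrightarrow> (\<forall>j < length L. L ! j \<bullet> state_of m X \<rho> \<le> \<rho> (Par j))"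
  using models_template_atom[OF assms] by (auto simp: template_def)

text \<open>The quantified names are the two state copies, so the parameters keep their values under
  \<open>\<rho>\<close> while the states range freely.\<close>

lemma models_correct_fm:
  assumes P: "prog_over m P" and L: "set L \<subseteq> carrier_vec m" and L': "set L' \<subseteq> carrier_vec m"
    and i: "i < length L'" and p: "\<forall>j < length L. \<rho> (ParIn j) = p $ j"
  shows "\<rho> \<Turnstile> correct_fm m P L L' i \<longleftrightarrow> \<rho> (ParOut i) \<in> post_bounds m P L p (L' ! i)"
proof -
  let ?xs = "map Pre [0..<m] @ map Post [0..<m]"
  let ?agree = "\<lambda>\<sigma>. \<forall>y. y \<notin> set ?xs \<longrightarrow> \<sigma> y = \<rho> y"
  let ?ok = "\<lambda>s s'. (\<forall>j < length L. L ! j \<bullet> s \<le> p $ j) \<and> exec P s s'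
    \<longrightarrow> L' ! i \<bullet> s' \<le> \<rho> (ParOut i)"
  have "\<rho> \<Turnstile> correct_fm m P L L' i \<longleftrightarrow>
      (\<forall>\<sigma>. ?agree \<sigma> \<longrightarrow>
        (\<forall>j < length L. L ! j \<bullet> state_of m Pre \<sigma> \<le> \<sigma> (ParIn j)) \<and>
        exec P (state_of m Pre \<sigma>) (state_of m Post \<sigma>) \<longrightarrow>
        L' ! i \<bullet> state_of m Post \<sigma> \<le> \<sigma> (ParOut i))"
    unfolding correct_fm_def
    by (subst models_All_fm)
      (simp_all add: models_template[OF L] models_template_atom[OF L' i] models_sem[OF P])
  \<comment> \<open>No parameter name is quantified, so \<open>\<sigma>\<close> and
    \<open>\<rho>\<close> agree on \<open>ParIn j\<close> and \<open>ParOut i\<close>.\<close>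
  also have "\<dots> \<longleftrightarrow> (\<forall>\<sigma>. ?agree \<sigma> \<longrightarrow> ?ok (state_of m Pre \<sigma>) (state_of m Post \<sigma>))"
    by (intro all_cong1 imp_cong refl) (auto simp: p image_iff)
  \<comment> \<open>Valuations are traded for pairs of states. Only \<open>s\<close> is restricted
    to the carrier, as execution then forces \<open>s'\<close> into it.\<close>
  also have "\<dots> \<longleftrightarrow> (\<forall>s s'. s \<in> carrier_vec m \<longrightarrow> ?ok s s')"
  proof (intro iffI allI impI)
    fix s s'
    assume ok: "\<forall>\<sigma>. ?agree \<sigma> \<longrightarrow> ?ok (state_of m Pre \<sigma>) (state_of m Post \<sigma>)"
      and s: "s \<in> carrier_vec m" and F: "(\<forall>j < length L. L ! j \<bullet> s \<le> p $ j) \<and> exec P s s'"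
    have s': "s' \<in> carrier_vec m" using F s exec_carrier by blast
    define \<sigma> where
      "\<sigma> x = (case x of Pre k \<Rightarrow> if k < m then s $ k else \<rho> x
        | Post k \<Rightarrow> if k < m then s' $ k else \<rho> x | _ \<Rightarrow> \<rho> x)" for x
    have "state_of m Pre \<sigma> = s" "state_of m Post \<sigma> = s'" using s s' by (auto simp: \<sigma>_def)
    moreover have "?agree \<sigma>" by (auto simp: \<sigma>_def split: name.split)
    ultimately have "?ok s s'" using ok by metis
    then show "L' ! i \<bullet> s' \<le> \<rho> (ParOut i)" using F by blast
  qed (use vec_carrier in blast)
  also have "\<dots> \<longleftrightarrow> \<rho> (ParOut i) \<in> post_bounds m P L p (L' ! i)"
    by (auto simp: post_bounds_def)
  finally show ?thesis .
qed

text \<open>The first conjunct of the formula yields membership and the quantified one the lower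
  bound. The field is arbitrary, which covers the rationals and the reals together.\<close>

lemma models_optimal_fm:
  assumes P: "prog_over m P" and L: "set L \<subseteq> carrier_vec m" and L': "set L' \<subseteq> carrier_vec m"
    and i: "i < length L'" and p: "\<forall>j < length L. \<rho> (ParIn j) = p $ j"
  shows "\<rho> \<Turnstile> optimal_fm m P L L' i \<longleftrightarrow>
    \<rho> (ParOut i) \<in> post_bounds m P L p (L' ! i) \<and>
    (\<forall>r \<in> post_bounds m P L p (L' ! i). \<rho> (ParOut i) \<le> r)"
proof -
  let ?C = "correct_fm m P L L' i" and ?B = "post_bounds m P L p (L' ! i)"
  \<comment> \<open>Composed with the renaming, the updated valuation sends \<open>ParOut i\<close>
    to \<open>r\<close> and each \<open>ParIn j\<close> where \<open>\<rho>\<close> does, so the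
    characterisation of \<open>?C\<close> applies with \<open>r\<close> as the bound.\<close>
  have subst: "\<rho>(ParOut' i := r) \<Turnstile> ?C[ParOut' i//ParOut i] \<longleftrightarrow> r \<in> ?B" for r
    unfolding subst_fm_def models_map_fm
    by (subst models_correct_fm[OF P L L' i]) (use p in auto)
  have "\<rho> \<Turnstile> All_fm [ParOut' i]
        (Impl (?C[ParOut' i//ParOut i]) (Leq (Free (ParOut i)) (Free (ParOut' i))))
      \<longleftrightarrow> (\<forall>r. \<rho>(ParOut' i := r) \<Turnstile> ?C[ParOut' i//ParOut i] \<longrightarrow> \<rho> (ParOut i) \<le> r)"
    \<comment> \<open>The block has one binder, so unfolding it gives the update form in which
      \<open>subst\<close> is stated.\<close>
    unfolding All_fm_def foldr.simps comp_def id_def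
    by (subst models_AllB_bind) (simp_all add: subst_fm_def lc_correct_fm)
  then show ?thesis
    using models_correct_fm[OF P L L' i p] by (auto simp: optimal_fm_def Let_def subst)
qed

theorem lemma1:
  fixes m n n' i :: nat
  assumes "i < n'"
  shows
    "(\<forall>(P :: rat prog) L L' p q \<rho>.
        prog_over m P \<longrightarrow>
        length L = n \<longrightarrow> set L \<subseteq> carrier_vec m \<longrightarrow>
        length L' = n' \<longrightarrow> set L' \<subseteq> carrier_vec m \<longrightarrow>
        p \<in> carrier_vec n \<longrightarrow> (\<forall>j < n. \<rho> (ParIn j) = p $ j) \<longrightarrow> \<rho> (ParOut i) = q \<longrightarrow>
        (\<rho> \<Turnstile> optimal_fm m P L L' i \<longleftrightarrow>
          q \<in> post_bounds m P L p (L' ! i) \<and> (\<forall>r \<in> post_bounds m P L p (L' ! i). q \<le> r)))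
     \<and>
     (\<forall>(P :: real prog) L L' p q \<rho>.
        prog_over m P \<longrightarrow>
        length L = n \<longrightarrow> set L \<subseteq> carrier_vec m \<longrightarrow>
        length L' = n' \<longrightarrow> set L' \<subseteq> carrier_vec m \<longrightarrow>
        p \<in> carrier_vec n \<longrightarrow> (\<forall>j < n. \<rho> (ParIn j) = p $ j) \<longrightarrow> \<rho> (ParOut i) = q \<longrightarrow>
        (\<rho> \<Turnstile> optimal_fm m P L L' i \<longleftrightarrow>
          q \<in> post_bounds m P L p (L' ! i) \<and> (\<forall>r \<in> post_bounds m P L p (L' ! i). q \<le> r)))"
  using assms by (intro conjI allI impI; metis models_optimal_fm)

end
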